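(* Let $X$ be a set, and consider the relations $\leq$ (Mitsch order) and $\subseteq$ (inclusion) on $\mathcal{B}_X$. Then: (i) the composite $\leq\circ\subseteq$ is contained in $\subseteq\circ\leq$; (ii) $\subseteq\circ\leq$ is the join of $\subseteq$ and $\leq$ in the lattice of preorders on $\mathcal{B}_X$.
   Context: $\mathcal{B}_X$ is the semigroup of all binary relations on $X$ (subsets of $X\times X$) under composition, written as juxtaposition: $(x,y)\in\alpha\beta$ iff there is $z\in X$ with $(x,z)\in\alpha$ and $(z,y)\in\beta$. The Mitsch order (natural partial order) $\leq$ on any semigroup $S$ is defined by: $a\leq b$ iff $a=b$ or there are $x,y\in S$ such that $a=ax=bx=yb$; here $S=\mathcal{B}_X$. For relations $\rho,\sigma$ on the set $\mathcal{B}_X$, the composite $\rho\circ\sigma$ relates $\alpha$ to $\beta$ iff there is $\gamma\in\mathcal{B}_X$ with $\alpha\,\rho\,\gamma$ and $\gamma\,\sigma\,\beta$; thus $\alpha\,(\subseteq\circ\leq)\,\beta$ iff $\alpha\subseteq\gamma\leq\beta$ for some $\gamma$. A preorder is a reflexive transitive relation; the preorders on $\mathcal{B}_X$, ordered by containment, form a lattice, in which the join of two preorders is the least preorder containing both. *)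

theory Defs
  imports "HOL-Algebra.Lattice"
begin

text \<open>The semigroup of binary relations on \<open>X\<close> has this carrier, and its product is \<open>(O)\<close>.\<close>

definition binrels :: "'a set \<Rightarrow> 'a rel set" where
  "binrels X = Pow (X \<times> X)"

text \<open>
  The natural partial order of a semigroup with carrier \<open>S\<close> and product \<open>f\<close>. The case \<open>a = b\<close> is
  not redundant, since the semigroup need not have an identity.
\<close>

definition mitsch_order :: "'s set \<Rightarrow> ('s \<Rightarrow> 's \<Rightarrow> 's) \<Rightarrow> 's rel" where
  "mitsch_order S f = {(a, b). a \<in> S \<and> b \<in> S \<and>
     (a = b \<or> (\<exists>x\<in>S. \<exists>y\<in>S. a = f a x \<and> a = f b x \<and> a = f y b))}"

definition mitsch :: "'a set \<Rightarrow> 'a rel rel" where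
  "mitsch X = mitsch_order (binrels X) (O)"

definition inclusion :: "'a set \<Rightarrow> 'a rel rel" where
  "inclusion X = {(\<alpha>, \<beta>). \<alpha> \<in> binrels X \<and> \<beta> \<in> binrels X \<and> \<alpha> \<subseteq> \<beta>}"

definition preorder_lattice :: "'s set \<Rightarrow> 's rel gorder" where
  "preorder_lattice S = \<lparr>carrier = {r. preorder_on S r}, eq = (=), le = (\<subseteq>)\<rparr>"

text \<open>
  Membership of \<open>a\<close> and \<open>b\<close> in the carrier is required explicitly because \<^const>\<open>Upper\<close> ignores
  elements outside the carrier.
\<close>

definition is_join :: "('s, 'm) gorder_scheme \<Rightarrow> 's \<Rightarrow> 's \<Rightarrow> 's \<Rightarrow> bool" where
  "is_join L a b j \<longleftrightarrow> a \<in> carrier L \<and> b \<in> carrier L \<and> least L j (Upper L {a, b})"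

end

theory Submission
  imports Defs
begin

text \<open>
  If \<open>\<alpha> \<le> \<beta> \<subseteq> \<gamma>\<close>, then \<open>\<alpha>\<close> is both a left and a right multiple of \<open>\<beta>\<close> (or equal to it), so its
  domain and range lie in those of \<open>\<gamma>\<close>; that is, \<open>\<alpha>\<close> is contained in the full rectangle
  \<open>Domain \<gamma> \<times> Range \<gamma>\<close>, which is always below \<open>\<gamma>\<close> in the Mitsch order. This gives (i). By (i) the
  composite \<open>\<subseteq> \<circ> \<le>\<close> is transitive, and hence it is the join.
\<close>

text \<open>Only transitivity takes work: multipliers \<open>x\<close>, \<open>y\<close> for the
  pair \<open>(a, b)\<close> and \<open>u\<close>, \<open>v\<close> for \<open>(b, c)\<close>
  combine into \<open>f u x\<close> and \<open>f y v\<close> for \<open>(a, c)\<close>.\<close>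

lemma preorder_on_mitsch_order:
  assumes closed: "\<And>a b. a \<in> S \<Longrightarrow> b \<in> S \<Longrightarrow> f a b \<in> S"
    and assoc: "\<And>a b c. a \<in> S \<Longrightarrow> b \<in> S \<Longrightarrow> c \<in> S \<Longrightarrow> f (f a b) c = f a (f b c)"
  shows "preorder_on S (mitsch_order S f)"
proof -
  have "(a, c) \<in> mitsch_order S f"
    if ab: "(a, b) \<in> mitsch_order S f" and bc: "(b, c) \<in> mitsch_order S f" for a b c
  proof (cases "a = b \<or> b = c")
    case True
    then show ?thesis using ab bc by auto
  next
    case False
    have S: "a \<in> S" "b \<in> S" "c \<in> S"
      using ab bc by (auto simp: mitsch_order_def)
    obtain x y where xy: "x \<in> S" "y \<in> S" "a = f a x" "a = f b x" "a = f y b"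
      using ab False by (auto simp: mitsch_order_def)
    obtain u v where uv: "u \<in> S" "v \<in> S" "b = f b u" "b = f c u" "b = f v c"
      using bc False by (auto simp: mitsch_order_def)
    \<comment> \<open>Since \<open>u\<close> fixes \<open>b\<close> on the right, it also fixes the
      left multiple \<open>a = f y b\<close>. Hence \<open>f u x\<close> fixes
      \<open>a\<close>.\<close>
    have "f a u = a"
      using S xy(2,5) uv(1,3) assoc by metis
    then have "a = f a (f u x)"
      using S xy(1,3) uv(1) assoc by metis
    moreover have "a = f c (f u x)"
      using S xy(1,4) uv(1,4) assoc by metis
    moreover have "a = f (f y v) c"
      using S xy(2,5) uv(2,5) assoc by metis
    ultimately show ?thesis
      using S xy uv closed unfolding mitsch_order_def by blast
  qed
  then have "trans (mitsch_order S f)"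
    by (rule transI)
  then show ?thesis
    by (auto simp: preorder_on_def refl_on_def mitsch_order_def)
qed

lemma preorder_on_mitsch: "preorder_on (binrels X) (mitsch X)"
  unfolding mitsch_def
  by (rule preorder_on_mitsch_order) (auto simp: binrels_def)

lemma preorder_on_inclusion: "preorder_on (binrels X) (inclusion X)"
  by (auto simp: preorder_on_def refl_on_def inclusion_def intro!: transI)

lemma rectangle_mitsch:
  assumes "\<gamma> \<in> binrels X"
  shows "(Domain \<gamma> \<times> Range \<gamma>, \<gamma>) \<in> mitsch X"
proof -
  \<comment> \<open>Composing with a full square erases which points \<gamma> links: each point of
    its domain becomes related to its whole range.\<close>
  let ?x = "Range \<gamma> \<times> Range \<gamma>" and ?y = "Domain \<gamma> \<times> Domain \<gamma>" and ?r = "Domain \<gamma> \<times> Range \<gamma>"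
  have "?x \<in> binrels X" "?y \<in> binrels X" "?r \<in> binrels X"
    using assms by (auto simp: binrels_def)
  moreover have "?r = ?r O ?x" "?r = \<gamma> O ?x" "?r = ?y O \<gamma>"
    by auto
  ultimately show ?thesis
    using assms unfolding mitsch_def mitsch_order_def by blast
qed

text \<open>A right multiple \<open>\<beta> O x\<close> cannot enlarge the domain of \<beta>, nor a
  left multiple \<open>y O \<beta>\<close> its range.\<close>

lemma mitsch_Domain_Range:
  assumes "(\<alpha>, \<beta>) \<in> mitsch X"
  shows "Domain \<alpha> \<subseteq> Domain \<beta>" "Range \<alpha> \<subseteq> Range \<beta>"
proof -
  consider "\<alpha> = \<beta>" | x y where "\<alpha> = \<beta> O x" "\<alpha> = y O \<beta>"
    using assms unfolding mitsch_def mitsch_order_def by blast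
  then have "Domain \<alpha> \<subseteq> Domain \<beta> \<and> Range \<alpha> \<subseteq> Range \<beta>"
    by cases blast+
  then show "Domain \<alpha> \<subseteq> Domain \<beta>" "Range \<alpha> \<subseteq> Range \<beta>"
    by auto
qed

lemma mitsch_inclusion_subset: "mitsch X O inclusion X \<subseteq> inclusion X O mitsch X"
proof clarify
  fix \<alpha> \<beta> \<gamma>
  assume ab: "(\<alpha>, \<beta>) \<in> mitsch X" and bc: "(\<beta>, \<gamma>) \<in> inclusion X"
  have carrier: "\<alpha> \<in> binrels X" "\<gamma> \<in> binrels X" and sub: "\<beta> \<subseteq> \<gamma>"
    using ab bc by (auto simp: mitsch_def mitsch_order_def inclusion_def)
  have "\<alpha> \<subseteq> Domain \<gamma> \<times> Range \<gamma>"
    using mitsch_Domain_Range[OF ab] sub by fast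
  then have "(\<alpha>, Domain \<gamma> \<times> Range \<gamma>) \<in> inclusion X"
    using carrier by (auto simp: inclusion_def binrels_def)
  then show "(\<alpha>, \<gamma>) \<in> inclusion X O mitsch X"
    using rectangle_mitsch[OF carrier(2)] by blast
qed

text \<open>This holds for preorders on any set. In \<open>r O s O r O s\<close>, the assumption
  \<open>comm\<close> swaps the middle factors, and transitivity of \<open>r\<close> and
  \<open>s\<close> then absorbs the repetitions. Reflexivity puts both factors inside
  \<open>r O s\<close>, and any transitive \<open>t\<close> above both contains it.\<close>

lemma is_join_relcomp:
  assumes r: "preorder_on S r" and s: "preorder_on S s" and comm: "s O r \<subseteq> r O s"
  shows "is_join (preorder_lattice S) r s (r O s)"
proof -
  have rs: "r \<subseteq> S \<times> S" "refl_on S r" "trans r" "s \<subseteq> S \<times> S" "refl_on S s" "trans s"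
    using r s by (auto simp: preorder_on_def)
  have "(r O s) O (r O s) = r O (s O r) O s"
    by (simp add: O_assoc)
  also have "\<dots> \<subseteq> r O (r O s) O s"
    by (intro relcomp_mono[OF subset_refl] relcomp_mono[OF comm] subset_refl)
  also have "\<dots> = (r O r) O (s O s)"
    by (simp add: O_assoc)
  also have "\<dots> \<subseteq> r O s"
    using rs(3,6) by (intro relcomp_mono trans_O_subset)
  finally have "trans (r O s)"
    unfolding trans_def by blast
  moreover have "refl_on S (r O s)" "r O s \<subseteq> S \<times> S"
    using rs by (auto simp: refl_on_def)
  ultimately have "preorder_on S (r O s)"
    by (simp add: preorder_on_def)
  moreover have "r \<subseteq> r O s" "s \<subseteq> r O s"
    using rs by (auto simp: refl_on_def)
  moreover have "r O s \<subseteq> t" if "preorder_on S t" "r \<subseteq> t" "s \<subseteq> t" for t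
    using that by (auto simp: preorder_on_def dest: transD)
  ultimately show ?thesis
    using r s by (auto simp: is_join_def preorder_lattice_def least_def Upper_def)
qed

theorem corollary5p2:
  fixes X :: "'a set"
  shows "mitsch X O inclusion X \<subseteq> inclusion X O mitsch X
    \<and> is_join (preorder_lattice (binrels X)) (inclusion X) (mitsch X) (inclusion X O mitsch X)"
  using mitsch_inclusion_subset preorder_on_inclusion preorder_on_mitsch is_join_relcomp by blast

end
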